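(* For every integer $n \ge 2$, the dimension of the polytope $\Omega_n$ is $\dim \Omega_n = \frac{n(n+1)}{2}$.
   Context: Fix an integer $n \ge 2$. Consider the rational affine space $\mathbb{Q}^{4n^2}$ whose coordinates are indexed as $X_{ijpq}$ with $i,j \in \{1,\dots,n\}$ and $p,q \in \{1,2\}$. For each function $\rho:\{1,\dots,n\}\to\{1,2\}$ define the point $X^{\rho}$ by $X^{\rho}_{ijpq}=1$ if $p=\rho(i)$ and $q=\rho(j)$, and $X^{\rho}_{ijpq}=0$ otherwise. The polytope $\Omega_n \subset \mathbb{Q}^{4n^2}$ is the convex hull of all the points $X^{\rho}$. The dimension of a polytope is the dimension of its affine hull. *)

theory Defs
  imports "HOL-Analysis.Analysis"
begin

text \<open>
  The library's \<^const>\<open>convex\<close>, \<^const>\<open>affine\<close> and \<^const>\<open>aff_dim\<close> are restricted to real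
  vector spaces.  The following are their analogues with rational scalars; the dimension of an
  affine hull is the linear dimension over the rationals of its space of directions, with the
  convention that the empty set has dimension \<open>-1\<close> (as for \<^const>\<open>aff_dim\<close>).
\<close>

definition rat_convex :: "(rat ^ 'k) set \<Rightarrow> bool" where
  "rat_convex S \<longleftrightarrow>
     (\<forall>x\<in>S. \<forall>y\<in>S. \<forall>u\<ge>0. \<forall>v\<ge>0. u + v = 1 \<longrightarrow> u *s x + v *s y \<in> S)"

definition rat_affine :: "(rat ^ 'k) set \<Rightarrow> bool" where
  "rat_affine S \<longleftrightarrow>
     (\<forall>x\<in>S. \<forall>y\<in>S. \<forall>u v. u + v = 1 \<longrightarrow> u *s x + v *s y \<in> S)"

definition rat_aff_dim :: "(rat ^ 'k) set \<Rightarrow> int" where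
  "rat_aff_dim S =
     (if S = {} then - 1
      else int (vec.dim {x - y | x y. x \<in> rat_affine hull S \<and> y \<in> rat_affine hull S}))"

text \<open>
  The index set \<open>{1,\<dots>,n}\<close> is rendered by an arbitrary finite type \<open>'n\<close> with \<open>n\<close> elements, and
  \<open>{1,2}\<close> by the two-element numeral type \<open>2\<close> (in which \<open>2 = 0\<close>).
\<close>

definition assignment_point :: "('n \<Rightarrow> 2) \<Rightarrow> rat ^ ('n::finite \<times> 'n \<times> 2 \<times> 2)" where
  "assignment_point \<rho> = (\<chi> k. case k of (i, j, p, q) \<Rightarrow> if p = \<rho> i \<and> q = \<rho> j then 1 else 0)"

definition Omega :: "(rat ^ ('n::finite \<times> 'n \<times> 2 \<times> 2)) set" where
  "Omega = rat_convex hull (range assignment_point)"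

end

theory Submission
  imports Defs
begin

text \<open>
  Let \<open>x\<^sub>i = 1\<close> if \<open>\<rho> i = 1\<close> and \<open>x\<^sub>i = 0\<close> otherwise.  Every coordinate of the point of \<open>\<rho>\<close> is a
  product of two factors \<open>x\<close> or \<open>1 - x\<close>, hence a polynomial of degree at most two in the \<open>x\<^sub>i\<close>,
  multilinear because \<open>x\<^sub>i\<^sup>2 = x\<^sub>i\<close>.  Its coefficient vectors at the monomials \<open>x\<^sub>i\<close> and \<open>x\<^sub>i x\<^sub>j\<close>, which
  are indexed by the sets with one or two elements, form a basis of the space of directions:
  Moebius inversion over these sets recovers them from differences of points, and they are
  independent because the coordinate \<open>(i, j, 1, 1)\<close> is the single monomial \<open>x\<^sub>i x\<^sub>j\<close>.
\<close>

text \<open>Indexing the points by the set where \<open>\<rho>\<close> equals 1 makes the monomial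
  expansion a sum over subsets.\<close>

definition vertex :: "'n set \<Rightarrow> rat ^ ('n::finite \<times> 'n \<times> 2 \<times> 2)" where
  "vertex T = assignment_point (\<lambda>i. if i \<in> T then 1 else 2)"

text \<open>\<open>offset p + slope p * x\<close> is \<open>x\<close> for \<open>p = 1\<close> and \<open>1 - x\<close> for \<open>p = 2\<close>.\<close>

definition offset :: "2 \<Rightarrow> rat" where
  "offset p = (if p = 1 then 0 else 1)"

definition slope :: "2 \<Rightarrow> rat" where
  "slope p = (if p = 1 then 1 else - 1)"

text \<open>The empty set is left out because the constant term cancels in differences of
  points.\<close>

definition monomials :: "'n set set" where
  "monomials = {S. card S = 1 \<or> card S = 2}"

text \<open>The summands are the terms in \<open>x_b\<close>, \<open>x_a\<close> and
  \<open>x_a x_b\<close> of the product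
  \<open>(offset p + slope p * x_a) * (offset q + slope q * x_b)\<close>. For \<open>a = b\<close>
  all three fall on the monomial of \<open>{a}\<close>, as \<open>x_a\<close> is idempotent.\<close>

definition coeff_vec :: "'n set \<Rightarrow> rat ^ ('n::finite \<times> 'n \<times> 2 \<times> 2)" where
  "coeff_vec S = (\<chi> k. case k of (a, b, p, q) \<Rightarrow>
     of_bool (S = {b}) * (offset p * slope q) + of_bool (S = {a}) * (offset q * slope p)
     + of_bool (S = {a, b}) * (slope p * slope q))"

lemma singleton_in_monomials [simp]: "{a} \<in> monomials"
  by (simp add: monomials_def)

lemma pair_in_monomials [simp]: "{a, b} \<in> monomials"
  by (cases "a = b") (simp_all add: monomials_def)

lemma monomials_cases:
  assumes "S \<in> monomials"
  obtains a b where "S = {a, b}"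
  using assms by (auto simp: monomials_def card_1_singleton_iff card_2_iff)

lemma range_assignment_point:
  "range (assignment_point :: ('n::finite \<Rightarrow> 2) \<Rightarrow> _) = range vertex"
proof
  show "range (assignment_point :: ('n \<Rightarrow> 2) \<Rightarrow> _) \<subseteq> range vertex"
  proof (rule image_subsetI)
    fix \<rho> :: "'n \<Rightarrow> 2"
    have "(if \<rho> i = 1 then 1 else 2) = \<rho> i" for i
      using exhaust_2[of "\<rho> i"] by auto
    then have "vertex {i. \<rho> i = 1} = assignment_point \<rho>"
      by (simp add: vertex_def)
    then show "assignment_point \<rho> \<in> range vertex"
      by (metis rangeI)
  qed
  show "range vertex \<subseteq> range (assignment_point :: ('n \<Rightarrow> 2) \<Rightarrow> _)"
    by (auto simp: vertex_def)
qed

lemma vertex_nth: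
  "vertex T $ (a, b, p, q) =
     (offset p + slope p * of_bool (a \<in> T)) * (offset q + slope q * of_bool (b \<in> T))"
  using exhaust_2[of p] exhaust_2[of q]
  by (auto simp: vertex_def assignment_point_def offset_def slope_def)

lemma coeff_vec_nth:
  "coeff_vec S $ (a, b, p, q) =
     of_bool (S = {b}) * (offset p * slope q) + of_bool (S = {a}) * (offset q * slope p)
     + of_bool (S = {a, b}) * (slope p * slope q)"
  by (simp add: coeff_vec_def)

text \<open>Both linear terms vanish since \<open>offset 1 = 0\<close>.\<close>

lemma coeff_vec_nth_1_1: "coeff_vec S $ (a, b, 1, 1) = of_bool (S = {a, b})"
  by (simp add: coeff_vec_nth offset_def slope_def)

text \<open>At the indicator of \<open>T\<close> the monomial of \<open>S\<close> takes the value 1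
  if \<open>S \<subseteq> T\<close> and 0 otherwise; subtracting \<open>vertex {}\<close> removes
  the constant term.\<close>

lemma vertex_expansion:
  fixes T :: "'n::finite set"
  shows "vertex T - vertex {} = (\<Sum>S\<in>{S \<in> monomials. S \<subseteq> T}. coeff_vec S)"
proof -
  have indicator: "(\<Sum>S\<in>{S \<in> monomials. S \<subseteq> T}. of_bool (S = U)) = (of_bool (U \<subseteq> T) :: rat)"
    if "U \<in> monomials" for U
    using that by (simp add: of_bool_def sum.delta)
  have "(\<Sum>S\<in>{S \<in> monomials. S \<subseteq> T}. coeff_vec S $ (a, b, p, q))
      = vertex T $ (a, b, p, q) - vertex {} $ (a, b, p, q)" for a b p q
  proof -
    have "(\<Sum>S\<in>{S \<in> monomials. S \<subseteq> T}. coeff_vec S $ (a, b, p, q))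
        = of_bool (b \<in> T) * (offset p * slope q) + of_bool (a \<in> T) * (offset q * slope p)
          + of_bool (a \<in> T \<and> b \<in> T) * (slope p * slope q)"
      unfolding coeff_vec_nth sum.distrib sum_distrib_right[symmetric] by (simp add: indicator)
    then show ?thesis
      by (simp add: vertex_nth algebra_simps)
  qed
  then show ?thesis
    by (simp add: vec_eq_iff)
qed

lemma coeff_vec_singleton: "coeff_vec {a} = vertex {a} - vertex {}"
proof -
  have "{S \<in> monomials. S \<subseteq> {a}} = {{a}}"
    by (auto simp: subset_singleton_iff monomials_def)
  then show ?thesis
    by (simp add: vertex_expansion)
qed

text \<open>Moebius inversion: the expansion at \<open>{a, b}\<close> has exactly three monomials,
  distinct because \<open>a \<noteq> b\<close>, and is solved for the quadratic one.\<close>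

lemma coeff_vec_pair:
  assumes "a \<noteq> b"
  shows "coeff_vec {a, b} = vertex {a, b} - vertex {} - coeff_vec {a} - coeff_vec {b}"
proof -
  have "{S \<in> monomials. S \<subseteq> {a, b}} = monomials \<inter> Pow {a, b}"
    by blast
  also have "\<dots> = monomials \<inter> {{}, {a}, {b}, {a, b}}"
    by (simp add: Pow_insert insert_commute)
  also have "\<dots> = {{a}, {b}, {a, b}}"
    by (simp add: monomials_def Int_insert_right assms)
  finally have "{S \<in> monomials. S \<subseteq> {a, b}} = {{a}, {b}, {a, b}}" .
  moreover have "{a} \<noteq> {b}" "{a} \<noteq> {a, b}" "{b} \<noteq> {a, b}"
    using assms by auto
  ultimately show ?thesis
    by (simp add: vertex_expansion)
qed

lemma inj_on_coeff_vec: "inj_on coeff_vec monomials"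
proof (rule inj_onI)
  fix S U :: "'n::finite set"
  assume "S \<in> monomials" and eq: "coeff_vec S = coeff_vec U"
  then obtain a b where "S = {a, b}"
    by (auto elim: monomials_cases)
  then show "S = U"
    using arg_cong[OF eq, of "\<lambda>v. v $ (a, b, 1, 1)"] by (simp add: coeff_vec_nth_1_1 split: if_splits)
qed

lemma independent_coeff_vec:
  "vec.independent (coeff_vec ` (monomials :: 'n::finite set set))"
proof (rule vec.independent_if_scalars_zero)
  fix f and v :: "rat ^ ('n \<times> 'n \<times> 2 \<times> 2)"
  assume zero: "(\<Sum>x\<in>coeff_vec ` (monomials :: 'n set set). f x *s x) = 0"
    and "v \<in> coeff_vec ` (monomials :: 'n set set)"
  then obtain a b :: 'n where v: "v = coeff_vec {a, b}"
    by (auto elim: monomials_cases)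
  \<comment> \<open>The coordinate \<open>(a, b, 1, 1)\<close> acts as a dual functional: it is 1 on
    \<open>coeff_vec {a, b}\<close> and 0 on the vectors of all other monomials, so it isolates one
    scalar.\<close>
  have "0 = (\<Sum>S\<in>monomials. f (coeff_vec S) *s coeff_vec S) $ (a, b, 1, 1)"
    using zero by (simp add: sum.reindex[OF inj_on_coeff_vec])
  also have "\<dots> = (\<Sum>S\<in>monomials. if S = {a, b} then f (coeff_vec S) else 0)"
    by (auto simp: coeff_vec_nth_1_1 intro!: sum.cong)
  also have "\<dots> = f v"
    by (simp add: v)
  finally show "f v = 0"
    by simp
qed simp

lemma card_monomials:
  "card (monomials :: 'n::finite set set) = CARD('n) + (CARD('n) choose 2)"
proof -
  have card_eq: "card {S :: 'n set. card S = k} = CARD('n) choose k" for k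
    using n_subsets[of "UNIV :: 'n set" k] by simp
  have "monomials = {S :: 'n set. card S = 1} \<union> {S. card S = 2}"
    by (auto simp: monomials_def)
  also have "card \<dots> = card {S :: 'n set. card S = 1} + card {S :: 'n set. card S = 2}"
    by (intro card_Un_disjoint) auto
  finally show ?thesis
    by (simp only: card_eq choose_one)
qed

lemma rat_affine_translated_span: "rat_affine {y. y - x \<in> vec.span V}"
  unfolding rat_affine_def
proof (intro ballI allI impI, simp only: mem_Collect_eq)
  fix y z :: "rat ^ 'a" and u v :: rat
  assume yz: "y - x \<in> vec.span V" "z - x \<in> vec.span V" and "u + v = 1"
  then have "u *s x + v *s x = x"
    by (metis vec.scale_left_distrib vec.scale_one)
  then have "u *s y + v *s z - x = u *s (y - x) + v *s (z - x)"
    by (simp add: algebra_simps)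
  then show "u *s y + v *s z - x \<in> vec.span V"
    by (simp only:) (intro vec.span_add vec.span_scale yz)
qed

lemma rat_affine_imp_convex: "rat_affine S \<Longrightarrow> rat_convex S"
  by (simp add: rat_affine_def rat_convex_def)

lemma vertex_in_Omega: "vertex T \<in> Omega"
  unfolding Omega_def range_assignment_point by (rule hull_inc) simp

text \<open>Equality of spans suffices for the dimension, so the set of directions need not be shown
  to be a subspace.\<close>

lemma Omega_directions_span:
  "vec.span {x - y | x y. x \<in> rat_affine hull Omega \<and> y \<in> rat_affine hull Omega}
     = vec.span (coeff_vec ` (monomials :: 'n::finite set set))"
  (is "vec.span ?D = vec.span ?C")
proof (rule vec.span_eq[THEN iffD2], intro conjI)
  have "vertex T - vertex {} \<in> ?D" for T :: "'n set"
    using hull_inc[OF vertex_in_Omega] by blast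
  then have diff: "vertex T - vertex {} \<in> vec.span ?D" for T :: "'n set"
    by (rule vec.span_base)
  show "?C \<subseteq> vec.span ?D"
  proof (clarify elim!: monomials_cases)
    fix a b :: 'n
    show "coeff_vec {a, b} \<in> vec.span ?D"
    proof (cases "a = b")
      case True
      with diff[of "{a}"] show ?thesis
        by (simp add: coeff_vec_singleton)
    next
      case False
      then show ?thesis
        unfolding coeff_vec_pair[OF False] coeff_vec_singleton
        by (intro vec.span_diff[OF vec.span_diff] diff)
    qed
  qed
next
  \<comment> \<open>The affine subspace through \<open>vertex {}\<close> with direction space
    \<open>vec.span ?C\<close>. It contains all vertices, hence by minimality first their convex
    hull and then the affine hull of that.\<close>
  let ?A = "{y. y - vertex {} \<in> vec.span ?C}"
  have "vertex T \<in> ?A" for T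
    unfolding mem_Collect_eq vertex_expansion by (intro vec.span_sum vec.span_base) auto
  then have "Omega \<subseteq> ?A"
    unfolding Omega_def range_assignment_point
    by (intro hull_minimal rat_affine_imp_convex rat_affine_translated_span) auto
  then have "rat_affine hull Omega \<subseteq> ?A"
    by (intro hull_minimal rat_affine_translated_span)
  then have "x - y \<in> vec.span ?C" if "x \<in> rat_affine hull Omega" "y \<in> rat_affine hull Omega" for x y
    using that vec.span_diff[of "x - vertex {}" ?C "y - vertex {}"] by auto
  then show "?D \<subseteq> vec.span ?C"
    by blast
qed

theorem theorem2:
  assumes "CARD('n::finite) \<ge> 2"
  shows "of_int (rat_aff_dim (Omega :: (rat ^ ('n \<times> 'n \<times> 2 \<times> 2)) set))
           = (of_nat (CARD('n) * (CARD('n) + 1)) / 2 :: rat)"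
proof -
  have "(Omega :: (rat ^ ('n \<times> 'n \<times> 2 \<times> 2)) set) \<noteq> {}"
    using vertex_in_Omega by blast
  then have "rat_aff_dim (Omega :: (rat ^ ('n \<times> 'n \<times> 2 \<times> 2)) set)
      = int (card (coeff_vec ` (monomials :: 'n set set)))"
    using vec.dim_eq_card[OF Omega_directions_span[symmetric] independent_coeff_vec]
    by (simp add: rat_aff_dim_def)
  also have "\<dots> = int (CARD('n) + (CARD('n) choose 2))"
    by (simp add: card_image inj_on_coeff_vec card_monomials)
  finally have dim: "rat_aff_dim (Omega :: (rat ^ ('n \<times> 'n \<times> 2 \<times> 2)) set)
      = int (CARD('n) + (CARD('n) choose 2))" .
  \<comment> \<open>Doubling clears the division in \<open>choose_two\<close>, and the case split
    resolves the truncated subtraction there.\<close>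
  have "2 * (CARD('n) + (CARD('n) choose 2)) = CARD('n) * (CARD('n) + 1)"
    by (cases "CARD('n)") (simp_all add: choose_two algebra_simps)
  then have "2 * (of_nat (CARD('n) + (CARD('n) choose 2)) :: rat) = of_nat (CARD('n) * (CARD('n) + 1))"
    by (metis of_nat_mult of_nat_numeral)
  then show ?thesis
    by (simp add: dim)
qed

end
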